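(* Let $\mathcal{C}$ be a congruence-modular equational class, let $A,B$ be members of $\mathcal{C}$ and let $f:A\to B$ be an admissible morphism in $\mathcal{C}$. Then: (1) if $f$ fulfills LO and $(\mathrm{Spec}(B),\subseteq)$ is a chain, then $f$ fulfills GU; (2) if $f$ fulfills LO and $\mathrm{Con}(B)$ is a chain, then $f$ fulfills GU.
   Context: An equational class (variety) $\mathcal{C}$ of algebras of a fixed type is congruence-modular if the congruence lattice $\mathrm{Con}(M)$ is modular for every member $M$ of $\mathcal{C}$. All algebras are non-empty; a morphism in $\mathcal{C}$ is a homomorphism between members of $\mathcal{C}$. For an algebra $M$, $\Delta_M$ is the equality relation and $\nabla_M=M^2$. In a congruence-modular class, the commutator $[\alpha,\beta]_M$ of $\alpha,\beta\in\mathrm{Con}(M)$ is the (Freese--McKenzie) modular commutator, i.e. the smallest congruence $\delta$ of $M$ such that, for every term $t(\bar x,\bar y)$ and all tuples $\bar a,\bar b,\bar c,\bar d$ of elements of $M$ with $(a_i,b_i)\in\alpha$ for all $i$ and $(c_j,d_j)\in\beta$ for all $j$, $(t(\bar a,\bar c),t(\bar a,\bar d))\in\delta$ implies $(t(\bar b,\bar c),t(\bar b,\bar d))\in\delta$. A congruence $\phi\neq\nabla_M$ is prime if, for all $\alpha,\beta\in\mathrm{Con}(M)$, $[\alpha,\beta]_M\subseteq\phi$ implies $\alpha\subseteq\phi$ or $\beta\subseteq\phi$; $\mathrm{Spec}(M)$ is the set of prime congruences of $M$. For a morphism $f:A\to B$ and $\psi\in\mathrm{Con}(B)$, $f^*(\psi)=\{(x,y)\in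 A^2 : (f(x),f(y))\in\psi\}\in\mathrm{Con}(A)$ and $\mathrm{Ker}(f)=f^*(\Delta_B)$. $f$ is admissible if $f^*(\psi)\in\mathrm{Spec}(A)$ for all $\psi\in\mathrm{Spec}(B)$. An admissible morphism $f:A\to B$ fulfills GU (Going Up) if for all $\phi,\psi\in\mathrm{Spec}(A)$ and $\phi_1\in\mathrm{Spec}(B)$ with $\phi\subseteq\psi$ and $f^*(\phi_1)=\phi$ there is $\psi_1\in\mathrm{Spec}(B)$ with $\phi_1\subseteq\psi_1$ and $f^*(\psi_1)=\psi$; it fulfills LO (Lying Over) if for every $\phi\in\mathrm{Spec}(A)$ with $\mathrm{Ker}(f)\subseteq\phi$ there is $\phi_1\in\mathrm{Spec}(B)$ with $f^*(\phi_1)=\phi$. *)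

theory Defs
  imports Main
begin

text \<open>Signatures, terms and algebras. A signature is a partial map: the domain is the set of
  operation symbols, the value is the (finite) arity. A set of symbols given as a domain, rather than
  a whole type, also covers the empty signature.\<close>

type_synonym 'f sig = "'f \<rightharpoonup> nat"

datatype ('f, 'v) trm = Var 'v | App 'f "('f, 'v) trm list"

inductive wf_trm :: "'f sig \<Rightarrow> ('f, 'v) trm \<Rightarrow> bool" for \<sigma> where
  Var: "wf_trm \<sigma> (Var x)"
| App: "\<sigma> f = Some (length ts) \<Longrightarrow> \<forall>t\<in>set ts. wf_trm \<sigma> t \<Longrightarrow> wf_trm \<sigma> (App f ts)"

record ('f, 'a) algebra =
  carrier :: "'a set"
  interp :: "'f \<Rightarrow> 'a list \<Rightarrow> 'a"

primrec eval :: "('f, 'a) algebra \<Rightarrow> ('v \<Rightarrow> 'a) \<Rightarrow> ('f, 'v) trm \<Rightarrow> 'a" where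
  "eval M v (Var x) = v x"
| "eval M v (App f ts) = interp M f (map (eval M v) ts)"

definition is_algebra :: "'f sig \<Rightarrow> ('f, 'a) algebra \<Rightarrow> bool" where
  "is_algebra \<sigma> M \<longleftrightarrow> carrier M \<noteq> {} \<and>
     (\<forall>f as. \<sigma> f = Some (length as) \<and> set as \<subseteq> carrier M \<longrightarrow> interp M f as \<in> carrier M)"

definition morphism ::
  "'f sig \<Rightarrow> ('f, 'a) algebra \<Rightarrow> ('f, 'b) algebra \<Rightarrow> ('a \<Rightarrow> 'b) \<Rightarrow> bool" where
  "morphism \<sigma> A B h \<longleftrightarrow> (\<forall>x\<in>carrier A. h x \<in> carrier B) \<and>
     (\<forall>f as. \<sigma> f = Some (length as) \<and> set as \<subseteq> carrier A \<longrightarrow>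
        h (interp A f as) = interp B f (map h as))"

text \<open>Equational classes are presented by a signature and a set of identities, each a pair of
  terms in countably many variables.\<close>

type_synonym 'f identities = "(('f, nat) trm \<times> ('f, nat) trm) set"

definition wf_identities :: "'f sig \<Rightarrow> 'f identities \<Rightarrow> bool" where
  "wf_identities \<sigma> E \<longleftrightarrow> (\<forall>(s, t)\<in>E. wf_trm \<sigma> s \<and> wf_trm \<sigma> t)"

definition equational_class :: "'f sig \<Rightarrow> 'f identities \<Rightarrow> ('f, 'a) algebra set" where
  "equational_class \<sigma> E = {M. is_algebra \<sigma> M \<and>
     (\<forall>(s, t)\<in>E. \<forall>v. range v \<subseteq> carrier M \<longrightarrow> eval M v s = eval M v t)}"

definition Con :: "'f sig \<Rightarrow> ('f, 'a) algebra \<Rightarrow> ('a \<times> 'a) set set" where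
  "Con \<sigma> M = {\<theta>. equiv (carrier M) \<theta> \<and>
     (\<forall>f as bs. \<sigma> f = Some (length as) \<and> list_all2 (\<lambda>a b. (a, b) \<in> \<theta>) as bs \<longrightarrow>
        (interp M f as, interp M f bs) \<in> \<theta>)}"

text \<open>The lattice \<open>Con(M)\<close>, ordered by inclusion: the meet is intersection, and the join is the
  least congruence containing both arguments (see \<open>con_join_least\<close>).\<close>

definition con_join ::
  "'f sig \<Rightarrow> ('f, 'a) algebra \<Rightarrow> ('a \<times> 'a) set \<Rightarrow> ('a \<times> 'a) set \<Rightarrow> ('a \<times> 'a) set" where
  "con_join \<sigma> M \<alpha> \<beta> = \<Inter>{\<theta> \<in> Con \<sigma> M. \<alpha> \<subseteq> \<theta> \<and> \<beta> \<subseteq> \<theta>}"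

definition con_modular :: "'f sig \<Rightarrow> ('f, 'a) algebra \<Rightarrow> bool" where
  "con_modular \<sigma> M \<longleftrightarrow> (\<forall>\<alpha>\<in>Con \<sigma> M. \<forall>\<beta>\<in>Con \<sigma> M. \<forall>\<gamma>\<in>Con \<sigma> M. \<alpha> \<subseteq> \<gamma> \<longrightarrow>
     con_join \<sigma> M \<alpha> \<beta> \<inter> \<gamma> = con_join \<sigma> M \<alpha> (\<beta> \<inter> \<gamma>))"

text \<open>A definition cannot quantify over the types of the carriers of the members, so one type is
  fixed, which is large enough to hold a copy of every countably generated algebra. The theorem
  \<open>congruence_modular_all_types\<close> below shows that congruence lattices of members over an arbitrary
  type are then modular as well, so nothing depends on this choice.\<close>

definition congruence_modular :: "'f sig \<Rightarrow> 'f identities \<Rightarrow> bool" where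
  "congruence_modular \<sigma> E \<longleftrightarrow>
     (\<forall>M \<in> (equational_class \<sigma> E :: ('f, ('f, nat) trm) algebra set). con_modular \<sigma> M)"

text \<open>The term condition defining the commutator. The variables of \<open>t(x,y)\<close> are \<open>Inl i\<close> (the
  \<open>x\<^sub>i\<close>) and \<open>Inr j\<close> (the \<open>y\<^sub>j\<close>). Tuples are extended to sequences, which is harmless
  since a term has finitely many variables and congruences are reflexive on a non-empty carrier.\<close>

definition term_condition :: "'f sig \<Rightarrow> ('f, 'a) algebra \<Rightarrow>
    ('a \<times> 'a) set \<Rightarrow> ('a \<times> 'a) set \<Rightarrow> ('a \<times> 'a) set \<Rightarrow> bool" where
  "term_condition \<sigma> M \<alpha> \<beta> \<delta> \<longleftrightarrow>
     (\<forall>(t :: ('f, nat + nat) trm) a b c d.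
        wf_trm \<sigma> t \<and> (\<forall>i. (a i, b i) \<in> \<alpha>) \<and> (\<forall>j. (c j, d j) \<in> \<beta>) \<and>
        (eval M (case_sum a c) t, eval M (case_sum a d) t) \<in> \<delta> \<longrightarrow>
        (eval M (case_sum b c) t, eval M (case_sum b d) t) \<in> \<delta>)"

text \<open>The smallest congruence satisfying the term condition (see \<open>commutator_least\<close>).\<close>

definition commutator ::
  "'f sig \<Rightarrow> ('f, 'a) algebra \<Rightarrow> ('a \<times> 'a) set \<Rightarrow> ('a \<times> 'a) set \<Rightarrow> ('a \<times> 'a) set" where
  "commutator \<sigma> M \<alpha> \<beta> = \<Inter>{\<delta> \<in> Con \<sigma> M. term_condition \<sigma> M \<alpha> \<beta> \<delta>}"

definition Spec :: "'f sig \<Rightarrow> ('f, 'a) algebra \<Rightarrow> ('a \<times> 'a) set set" where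
  "Spec \<sigma> M = {\<phi> \<in> Con \<sigma> M. \<phi> \<noteq> carrier M \<times> carrier M \<and>
     (\<forall>\<alpha>\<in>Con \<sigma> M. \<forall>\<beta>\<in>Con \<sigma> M. commutator \<sigma> M \<alpha> \<beta> \<subseteq> \<phi> \<longrightarrow> \<alpha> \<subseteq> \<phi> \<or> \<beta> \<subseteq> \<phi>)}"

definition pullback :: "('f, 'a) algebra \<Rightarrow> ('a \<Rightarrow> 'b) \<Rightarrow> ('b \<times> 'b) set \<Rightarrow> ('a \<times> 'a) set" where
  "pullback A f \<psi> = {(x, y) \<in> carrier A \<times> carrier A. (f x, f y) \<in> \<psi>}"

definition Ker :: "('f, 'a) algebra \<Rightarrow> ('f, 'b) algebra \<Rightarrow> ('a \<Rightarrow> 'b) \<Rightarrow> ('a \<times> 'a) set" where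
  "Ker A B f = pullback A f (Id_on (carrier B))"

definition admissible ::
  "'f sig \<Rightarrow> ('f, 'a) algebra \<Rightarrow> ('f, 'b) algebra \<Rightarrow> ('a \<Rightarrow> 'b) \<Rightarrow> bool" where
  "admissible \<sigma> A B f \<longleftrightarrow> (\<forall>\<psi>\<in>Spec \<sigma> B. pullback A f \<psi> \<in> Spec \<sigma> A)"

definition going_up ::
  "'f sig \<Rightarrow> ('f, 'a) algebra \<Rightarrow> ('f, 'b) algebra \<Rightarrow> ('a \<Rightarrow> 'b) \<Rightarrow> bool" where
  "going_up \<sigma> A B f \<longleftrightarrow>
     (\<forall>\<phi>\<in>Spec \<sigma> A. \<forall>\<psi>\<in>Spec \<sigma> A. \<forall>\<phi>\<^sub>1\<in>Spec \<sigma> B. \<phi> \<subseteq> \<psi> \<and> pullback A f \<phi>\<^sub>1 = \<phi> \<longrightarrow>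
        (\<exists>\<psi>\<^sub>1\<in>Spec \<sigma> B. \<phi>\<^sub>1 \<subseteq> \<psi>\<^sub>1 \<and> pullback A f \<psi>\<^sub>1 = \<psi>))"

definition lying_over ::
  "'f sig \<Rightarrow> ('f, 'a) algebra \<Rightarrow> ('f, 'b) algebra \<Rightarrow> ('a \<Rightarrow> 'b) \<Rightarrow> bool" where
  "lying_over \<sigma> A B f \<longleftrightarrow>
     (\<forall>\<phi>\<in>Spec \<sigma> A. Ker A B f \<subseteq> \<phi> \<longrightarrow> (\<exists>\<phi>\<^sub>1\<in>Spec \<sigma> B. pullback A f \<phi>\<^sub>1 = \<phi>))"


section \<open>Joins and commutators are least congruences\<close>

lemma full_Con: "is_algebra \<sigma> M \<Longrightarrow> carrier M \<times> carrier M \<in> Con \<sigma> M"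
proof -
  assume M: "is_algebra \<sigma> M"
  have "interp M f as \<in> carrier M \<and> interp M f bs \<in> carrier M"
    if "\<sigma> f = Some (length as)"
      and "list_all2 (\<lambda>a b. (a, b) \<in> carrier M \<times> carrier M) as bs" for f as bs
  proof -
    from that(2) have "length as = length bs" "set as \<subseteq> carrier M" "set bs \<subseteq> carrier M"
      by (induction rule: list_all2_induct) auto
    with that(1) M show ?thesis by (auto simp: is_algebra_def)
  qed
  moreover have "equiv (carrier M) (carrier M \<times> carrier M)"
    by (auto simp: equiv_def refl_on_def sym_def trans_def)
  ultimately show ?thesis unfolding Con_def by blast
qed

lemma Inter_Con:
  assumes "S \<subseteq> Con \<sigma> M" "S \<noteq> {}"
  shows "\<Inter>S \<in> Con \<sigma> M"
proof -
  have eq: "equiv (carrier M) \<theta>"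
    and op: "\<And>f as bs. \<sigma> f = Some (length as) \<Longrightarrow> list_all2 (\<lambda>a b. (a, b) \<in> \<theta>) as bs \<Longrightarrow>
       (interp M f as, interp M f bs) \<in> \<theta>" if "\<theta> \<in> S" for \<theta>
    using assms(1) that by (auto simp: Con_def)
  have "equiv (carrier M) (\<Inter>S)"
  proof (rule equivI)
    show "\<Inter>S \<subseteq> carrier M \<times> carrier M"
      using assms(2) eq by (auto simp: equiv_def)
    show "refl_on (carrier M) (\<Inter>S)"
      using eq by (auto simp: equiv_def refl_on_def)
    show "sym (\<Inter>S)"
      using eq by (auto simp: equiv_def sym_def)
    show "trans (\<Inter>S)"
      using eq unfolding equiv_def trans_def by blast
  qed
  moreover have "(interp M f as, interp M f bs) \<in> \<theta>"
    if "\<sigma> f = Some (length as)" "list_all2 (\<lambda>a b. (a, b) \<in> \<Inter>S) as bs" "\<theta> \<in> S" for f as bs \<theta>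
    using that by (intro op) (auto elim!: list_all2_mono)
  ultimately show ?thesis by (auto simp: Con_def)
qed

lemma Con_subset: "\<alpha> \<in> Con \<sigma> M \<Longrightarrow> \<alpha> \<subseteq> carrier M \<times> carrier M"
  by (auto simp: Con_def equiv_def)

lemma Con_Int: "\<alpha> \<in> Con \<sigma> M \<Longrightarrow> \<beta> \<in> Con \<sigma> M \<Longrightarrow> \<alpha> \<inter> \<beta> \<in> Con \<sigma> M"
  using Inter_Con[of "{\<alpha>, \<beta>}" \<sigma> M] by simp

lemma con_join_least:
  assumes "is_algebra \<sigma> M" "\<alpha> \<in> Con \<sigma> M" "\<beta> \<in> Con \<sigma> M"
  shows "con_join \<sigma> M \<alpha> \<beta> \<in> Con \<sigma> M" "\<alpha> \<subseteq> con_join \<sigma> M \<alpha> \<beta>" "\<beta> \<subseteq> con_join \<sigma> M \<alpha> \<beta>"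
    and "\<And>\<theta>. \<theta> \<in> Con \<sigma> M \<Longrightarrow> \<alpha> \<subseteq> \<theta> \<Longrightarrow> \<beta> \<subseteq> \<theta> \<Longrightarrow> con_join \<sigma> M \<alpha> \<beta> \<subseteq> \<theta>"
proof -
  show "con_join \<sigma> M \<alpha> \<beta> \<in> Con \<sigma> M"
    unfolding con_join_def
    using full_Con[OF assms(1)] assms(2,3)[THEN Con_subset] by (intro Inter_Con) auto
qed (auto simp: con_join_def)

lemma eval_closed:
  assumes "is_algebra \<sigma> M" "wf_trm \<sigma> t" "\<And>x. v x \<in> carrier M"
  shows "eval M v t \<in> carrier M"
  using assms(2)
proof induction
  case (App f ts)
  then have "set (map (eval M v) ts) \<subseteq> carrier M" by auto
  with App.hyps assms(1) show ?case unfolding is_algebra_def by (metis eval.simps(2) length_map)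
qed (simp add: assms)

lemma commutator_least:
  fixes M :: "('f, 'a) algebra"
  assumes "is_algebra \<sigma> M" "\<alpha> \<in> Con \<sigma> M" "\<beta> \<in> Con \<sigma> M"
  shows "commutator \<sigma> M \<alpha> \<beta> \<in> Con \<sigma> M" "term_condition \<sigma> M \<alpha> \<beta> (commutator \<sigma> M \<alpha> \<beta>)"
    and "\<And>\<delta>. \<delta> \<in> Con \<sigma> M \<Longrightarrow> term_condition \<sigma> M \<alpha> \<beta> \<delta> \<Longrightarrow> commutator \<sigma> M \<alpha> \<beta> \<subseteq> \<delta>"
proof -
  have "term_condition \<sigma> M \<alpha> \<beta> (carrier M \<times> carrier M)"
    unfolding term_condition_def
  proof (intro allI impI, elim conjE)
    fix t :: "('f, nat + nat) trm" and a b c d :: "nat \<Rightarrow> 'a"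
    assume "wf_trm \<sigma> t" and ab: "\<forall>i. (a i, b i) \<in> \<alpha>" and cd: "\<forall>j. (c j, d j) \<in> \<beta>"
    have "b i \<in> carrier M" "c i \<in> carrier M" "d i \<in> carrier M" for i
      using ab cd assms(2,3)[THEN Con_subset] by blast+
    then have "case_sum b c x \<in> carrier M" "case_sum b d x \<in> carrier M" for x
      by (cases x; simp)+
    then show "(eval M (case_sum b c) t, eval M (case_sum b d) t) \<in> carrier M \<times> carrier M"
      using eval_closed[OF assms(1) \<open>wf_trm \<sigma> t\<close>] by blast
  qed
  then show "commutator \<sigma> M \<alpha> \<beta> \<in> Con \<sigma> M"
    unfolding commutator_def using full_Con[OF assms(1)] by (intro Inter_Con) auto
  show "term_condition \<sigma> M \<alpha> \<beta> (commutator \<sigma> M \<alpha> \<beta>)"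
    unfolding term_condition_def
  proof (intro allI impI, elim conjE)
    fix t :: "('f, nat + nat) trm" and a b c d :: "nat \<Rightarrow> 'a"
    assume *: "wf_trm \<sigma> t" "\<forall>i. (a i, b i) \<in> \<alpha>" "\<forall>j. (c j, d j) \<in> \<beta>"
      "(eval M (case_sum a c) t, eval M (case_sum a d) t) \<in> commutator \<sigma> M \<alpha> \<beta>"
    have "(eval M (case_sum b c) t, eval M (case_sum b d) t) \<in> \<delta>"
      if "\<delta> \<in> Con \<sigma> M" "term_condition \<sigma> M \<alpha> \<beta> \<delta>" for \<delta>
    proof -
      from *(4) that have "(eval M (case_sum a c) t, eval M (case_sum a d) t) \<in> \<delta>"
        by (auto simp: commutator_def)
      with that(2) *(1-3) show ?thesis unfolding term_condition_def by blast
    qed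
    then show "(eval M (case_sum b c) t, eval M (case_sum b d) t) \<in> commutator \<sigma> M \<alpha> \<beta>"
      by (auto simp: commutator_def)
  qed
qed (auto simp: commutator_def)


section \<open>Congruence modularity does not depend on the carrier type\<close>

lemma pullback_Con:
  assumes "is_algebra \<sigma> A" "morphism \<sigma> A B h" "\<theta> \<in> Con \<sigma> B"
  shows "pullback A h \<theta> \<in> Con \<sigma> A"
proof -
  have eq: "equiv (carrier B) \<theta>"
    and op: "\<And>f as bs. \<sigma> f = Some (length as) \<Longrightarrow> list_all2 (\<lambda>a b. (a, b) \<in> \<theta>) as bs \<Longrightarrow>
       (interp B f as, interp B f bs) \<in> \<theta>"
    using assms(3) by (auto simp: Con_def)
  have "equiv (carrier A) (pullback A h \<theta>)"
  proof (rule equivI)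
    show "pullback A h \<theta> \<subseteq> carrier A \<times> carrier A" by (auto simp: pullback_def)
    show "refl_on (carrier A) (pullback A h \<theta>)"
      using eq assms(2) by (auto simp: equiv_def pullback_def refl_on_def morphism_def)
    show "sym (pullback A h \<theta>)"
      using eq unfolding equiv_def pullback_def sym_def by blast
    show "trans (pullback A h \<theta>)"
      using eq unfolding equiv_def pullback_def trans_def by blast
  qed
  moreover have "(interp A f as, interp A f bs) \<in> pullback A h \<theta>"
    if 1: "\<sigma> f = Some (length as)"
      and 2: "list_all2 (\<lambda>a b. (a, b) \<in> pullback A h \<theta>) as bs" for f as bs
  proof -
    from 2 have l: "length as = length bs" "set as \<subseteq> carrier A" "set bs \<subseteq> carrier A"
      "list_all2 (\<lambda>a b. (a, b) \<in> \<theta>) (map h as) (map h bs)"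
      by (induction rule: list_all2_induct) (auto simp: pullback_def)
    have "(interp B f (map h as), interp B f (map h bs)) \<in> \<theta>"
      using 1 l by (intro op) auto
    moreover have "interp A f as \<in> carrier A" "interp A f bs \<in> carrier A"
      using assms(1) 1 l by (auto simp: is_algebra_def)
    moreover have "h (interp A f as) = interp B f (map h as)"
      "h (interp A f bs) = interp B f (map h bs)"
      using assms(2) 1 l by (auto simp: morphism_def)
    ultimately show ?thesis by (simp add: pullback_def)
  qed
  ultimately show ?thesis by (simp add: Con_def)
qed

lemma eval_morphism:
  assumes "is_algebra \<sigma> A" "morphism \<sigma> A B h" "wf_trm \<sigma> t" "\<And>x. v x \<in> carrier A"
  shows "h (eval A v t) = eval B (\<lambda>x. h (v x)) t"
  using assms(3)
proof induction
  case (App f ts)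
  have "set (map (eval A v) ts) \<subseteq> carrier A"
    using App eval_closed[OF assms(1)] assms(4) by auto
  then have "h (eval A v (App f ts)) = interp B f (map h (map (eval A v) ts))"
    using App.hyps assms(2) unfolding morphism_def by (metis eval.simps(2) length_map)
  also have "map h (map (eval A v) ts) = map (eval B (\<lambda>x. h (v x))) ts"
    using App by auto
  finally show ?case by simp
qed simp

lemma trancl_Con:
  assumes M: "is_algebra \<sigma> M" and C: "\<alpha> \<in> Con \<sigma> M" "\<beta> \<in> Con \<sigma> M"
  shows "(\<alpha> \<union> \<beta>)\<^sup>+ \<in> Con \<sigma> M"
proof -
  let ?R = "\<alpha> \<union> \<beta>"
  have eq: "equiv (carrier M) \<alpha>" "equiv (carrier M) \<beta>" using C by (auto simp: Con_def)
  have sub: "?R\<^sup>+ \<subseteq> carrier M \<times> carrier M"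
    using C[THEN Con_subset] by (intro trancl_subset_Sigma) auto
  have refl: "(x, x) \<in> \<alpha>" "(x, x) \<in> \<beta>" if "x \<in> carrier M" for x
    using eq that by (auto simp: equiv_def refl_on_def)
  have equiv: "equiv (carrier M) (?R\<^sup>+)"
  proof (rule equivI[OF sub])
    show "refl_on (carrier M) (?R\<^sup>+)" using refl by (auto simp: refl_on_def)
    show "sym (?R\<^sup>+)" using eq by (intro sym_trancl sym_Un) (auto simp: equiv_def)
  qed simp
  have refl_list: "list_all2 (\<lambda>a b. (a, b) \<in> \<alpha>) xs xs" "list_all2 (\<lambda>a b. (a, b) \<in> \<beta>) xs xs"
    if "set xs \<subseteq> carrier M" for xs
    using that refl by (auto intro!: list_all2_refl simp: list_all2_same)
  have one: "(interp M f (ps @ x # xs), interp M f (ps @ y # xs)) \<in> ?R\<^sup>+"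
    if "(x, y) \<in> ?R\<^sup>+" and f: "\<sigma> f = Some (length ps + Suc (length xs))"
      "set ps \<subseteq> carrier M" "set xs \<subseteq> carrier M" for f ps x y xs
  proof -
    have one_step: "(interp M f (ps @ u # xs), interp M f (ps @ w # xs)) \<in> ?R" if "(u, w) \<in> ?R" for u w
    proof (cases "(u, w) \<in> \<alpha>")
      case True
      then have "list_all2 (\<lambda>a b. (a, b) \<in> \<alpha>) (ps @ u # xs) (ps @ w # xs)"
        using f refl_list by (auto intro!: list_all2_appendI)
      then show ?thesis using C(1) f(1) by (auto simp: Con_def)
    next
      case False
      with that have "list_all2 (\<lambda>a b. (a, b) \<in> \<beta>) (ps @ u # xs) (ps @ w # xs)"
        using f refl_list by (auto intro!: list_all2_appendI)
      then show ?thesis using C(2) f(1) by (auto simp: Con_def)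
    qed
    from \<open>(x, y) \<in> ?R\<^sup>+\<close> show ?thesis
    proof induction
      case (base y)
      then show ?case by (rule one_step[THEN r_into_trancl])
    next
      case (step y z)
      show ?case by (rule trancl_into_trancl[OF step.IH one_step[OF step.hyps(2)]])
    qed
  qed
  have many: "(interp M f (ps @ xs), interp M f (ps @ ys)) \<in> ?R\<^sup>+"
    if "list_all2 (\<lambda>a b. (a, b) \<in> ?R\<^sup>+) xs ys" "\<sigma> f = Some (length ps + length xs)"
      "set ps \<subseteq> carrier M" for f ps xs ys
    using that
  proof (induction xs ys arbitrary: ps rule: list_all2_induct)
    case Nil
    then have "interp M f ps \<in> carrier M" using M by (auto simp: is_algebra_def)
    then show ?case using refl by auto
  next
    case (Cons x xs y ys)
    from Cons.hyps(2) have "set xs \<subseteq> carrier M"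
      by (induction rule: list_all2_induct) (use sub in auto)
    then have "(interp M f (ps @ x # xs), interp M f (ps @ y # xs)) \<in> ?R\<^sup>+"
      using Cons.prems Cons.hyps by (intro one) auto
    also have "(interp M f ((ps @ [y]) @ xs), interp M f ((ps @ [y]) @ ys)) \<in> ?R\<^sup>+"
      using Cons.prems Cons.hyps(1) sub by (intro Cons.IH) auto
    then have "(interp M f (ps @ y # xs), interp M f (ps @ y # ys)) \<in> ?R\<^sup>+" by simp
    finally show ?case .
  qed
  from equiv many[of _ _ _ "[]"] show ?thesis by (simp add: Con_def)
qed

lemma trancl_finite_support:
  assumes "(x, y) \<in> R\<^sup>+"
  shows "\<exists>F. finite F \<and> x \<in> F \<and> y \<in> F \<and> F \<subseteq> Field R \<and> (x, y) \<in> (R \<inter> F \<times> F)\<^sup>+"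
  using assms
proof induction
  case (base y)
  then show ?case by (intro exI[of _ "{x, y}"]) (auto simp: Field_def)
next
  case (step y z)
  then obtain F where F: "finite F" "x \<in> F" "y \<in> F" "F \<subseteq> Field R" "(x, y) \<in> (R \<inter> F \<times> F)\<^sup>+"
    by blast
  have "(x, y) \<in> (R \<inter> insert z F \<times> insert z F)\<^sup>+"
    using F(5) by (rule trancl_mono) auto
  moreover have "(y, z) \<in> R \<inter> insert z F \<times> insert z F" using step F by auto
  ultimately have "(x, z) \<in> (R \<inter> insert z F \<times> insert z F)\<^sup>+"
    by (rule trancl_into_trancl)
  then show ?case using F step by (intro exI[of _ "insert z F"]) (auto simp: Field_def)
qed

theorem congruence_modular_all_types:
  fixes M :: "('f, 'a) algebra"
  assumes E: "wf_identities \<sigma> E" and mod: "congruence_modular \<sigma> E" and M: "M \<in> equational_class \<sigma> E"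
  shows "con_modular \<sigma> M"
  unfolding con_modular_def
proof (intro ballI impI equalityI)
  fix \<alpha> \<beta> \<gamma>
  assume C: "\<alpha> \<in> Con \<sigma> M" "\<beta> \<in> Con \<sigma> M" "\<gamma> \<in> Con \<sigma> M" and "\<alpha> \<subseteq> \<gamma>"
  have alg: "is_algebra \<sigma> M" using M by (simp add: equational_class_def)
  note bg = Con_Int[OF C(2,3)]
  let ?K = "con_join \<sigma> M \<alpha> (\<beta> \<inter> \<gamma>)"
  show "?K \<subseteq> con_join \<sigma> M \<alpha> \<beta> \<inter> \<gamma>"
    using con_join_least[OF alg C(1,2)] \<open>\<alpha> \<subseteq> \<gamma>\<close> C
    by (intro con_join_least(4)[OF alg C(1) bg] Con_Int) auto
  show "con_join \<sigma> M \<alpha> \<beta> \<inter> \<gamma> \<subseteq> ?K"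
  proof clarify
    fix x y assume xy: "(x, y) \<in> con_join \<sigma> M \<alpha> \<beta>" "(x, y) \<in> \<gamma>"
    have "con_join \<sigma> M \<alpha> \<beta> \<subseteq> (\<alpha> \<union> \<beta>)\<^sup>+"
      by (intro con_join_least(4)[OF alg C(1,2)] trancl_Con[OF alg C(1,2)]) auto
    with xy obtain F where F: "finite F" "x \<in> F" "y \<in> F" "F \<subseteq> Field (\<alpha> \<union> \<beta>)"
      "(x, y) \<in> ((\<alpha> \<union> \<beta>) \<inter> F \<times> F)\<^sup>+" using trancl_finite_support by (metis subsetD)
    have FM: "F \<subseteq> carrier M"
      using F(4) C(1,2)[THEN Con_subset] by (auto simp: Field_def)
    obtain n and e :: "nat \<Rightarrow> 'a" where e: "F = e ` {i. i < n}"
      using F(1) by (auto simp: finite_conv_nat_seg_image)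
    define v where "v i = (if i < n then e i else x)" for i
    have v: "range v = F" using F(2) e by (auto simp: v_def)
    then have vM: "v i \<in> carrier M" for i using FM by auto

    \<comment> \<open>a copy, on terms, of the subalgebra generated by \<open>F\<close>\<close>
    define h where "h = eval M v"
    define T where "T = {t :: ('f, nat) trm. wf_trm \<sigma> t}"
    define j where "j a = (SOME t. t \<in> T \<and> h t = a)" for a
    have j: "j (h t) \<in> T" "h (j (h t)) = h t" if "t \<in> T" for t
      using someI[of "\<lambda>s. s \<in> T \<and> h s = h t" t] that by (auto simp: j_def)
    define N where "N = \<lparr>carrier = j ` h ` T, interp = \<lambda>f ts. j (interp M f (map h ts))\<rparr>"
    have NT: "carrier N \<subseteq> T" using j by (auto simp: N_def)
    have jh: "j (h t) = t" if "t \<in> carrier N" for t using that j by (auto simp: N_def)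
    have opT: "interp M f (map h ts) = h (App f ts) \<and> App f ts \<in> T"
      if "\<sigma> f = Some (length ts)" "set ts \<subseteq> carrier N" for f ts
      using that NT by (auto simp: h_def T_def intro!: wf_trm.App)
    have Nalg: "is_algebra \<sigma> N"
      unfolding is_algebra_def
    proof (intro conjI allI impI; (elim conjE)?)
      have "Var 0 \<in> T" by (simp add: T_def wf_trm.Var)
      then show "carrier N \<noteq> {}" by (auto simp: N_def)
    next
      fix f ts assume "\<sigma> f = Some (length ts)" "set ts \<subseteq> carrier N"
      from opT[OF this] show "interp N f ts \<in> carrier N" by (auto simp: N_def)
    qed
    have hom: "morphism \<sigma> N M h"
      unfolding morphism_def
    proof (intro conjI allI impI ballI; (elim conjE)?)
      fix t assume "t \<in> carrier N"
      then show "h t \<in> carrier M"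
        using NT vM eval_closed[OF alg] by (auto simp: T_def h_def)
    next
      fix f ts assume "\<sigma> f = Some (length ts)" "set ts \<subseteq> carrier N"
      from opT[OF this] show "h (interp N f ts) = interp M f (map h ts)"
        using j(2) by (auto simp: N_def)
    qed
    have "N \<in> equational_class \<sigma> E"
      unfolding equational_class_def
    proof (intro CollectI conjI Nalg, clarify)
      fix s t and w :: "nat \<Rightarrow> ('f, nat) trm"
      assume st: "(s, t) \<in> E" and w: "range w \<subseteq> carrier N"
      have wf: "wf_trm \<sigma> s" "wf_trm \<sigma> t" using E st by (auto simp: wf_identities_def)
      have "range (\<lambda>i. h (w i)) \<subseteq> carrier M" using w hom by (auto simp: morphism_def)
      then have "eval M (\<lambda>i. h (w i)) s = eval M (\<lambda>i. h (w i)) t"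
        using M st by (auto simp: equational_class_def)
      then have "h (eval N w s) = h (eval N w t)"
        using w by (simp add: eval_morphism[OF Nalg hom wf(1)] eval_morphism[OF Nalg hom wf(2)] image_subset_iff)
      moreover have "eval N w s \<in> carrier N" "eval N w t \<in> carrier N"
        using w by (auto intro!: eval_closed[OF Nalg] wf)
      ultimately show "eval N w s = eval N w t" using jh by metis
    qed
    then have Nmod: "con_modular \<sigma> N" using mod by (auto simp: congruence_modular_def)

    let ?p = "pullback N h"
    have P: "?p \<theta> \<in> Con \<sigma> N" if "\<theta> \<in> Con \<sigma> M" for \<theta>
      using pullback_Con[OF Nalg hom that] .
    have jF: "j a \<in> carrier N \<and> h (j a) = a" if "a \<in> F" for a
    proof -
      from that v obtain i where "v i = a" by blast
      then have "a = h (Var i)" by (simp add: h_def)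
      moreover have "Var i \<in> T" by (simp add: T_def wf_trm.Var)
      ultimately show ?thesis using j by (auto simp: N_def)
    qed
    have NJ: "con_join \<sigma> N (?p \<alpha>) (?p \<beta>) \<in> Con \<sigma> N" "?p \<alpha> \<subseteq> con_join \<sigma> N (?p \<alpha>) (?p \<beta>)"
      "?p \<beta> \<subseteq> con_join \<sigma> N (?p \<alpha>) (?p \<beta>)"
      using con_join_least[OF Nalg P[OF C(1)] P[OF C(2)]] by auto
    have link: "(j a, j b) \<in> con_join \<sigma> N (?p \<alpha>) (?p \<beta>)" if "(a, b) \<in> (\<alpha> \<union> \<beta>) \<inter> F \<times> F" for a b
    proof -
      have "(j a, j b) \<in> ?p \<alpha> \<union> ?p \<beta>" using that jF by (auto simp: pullback_def)
      then show ?thesis using NJ by blast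
    qed
    have trans: "trans (con_join \<sigma> N (?p \<alpha>) (?p \<beta>))" using NJ(1) by (auto simp: Con_def equiv_def)
    have "(j x, j y) \<in> con_join \<sigma> N (?p \<alpha>) (?p \<beta>)"
      using F(5)
    proof induction
      case (base b)
      then show ?case by (rule link)
    next
      case (step b c)
      show ?case by (rule transD[OF trans step.IH link[OF step.hyps(2)]])
    qed
    moreover have "(j x, j y) \<in> ?p \<gamma>" using xy(2) jF F by (auto simp: pullback_def)
    moreover have "?p \<alpha> \<subseteq> ?p \<gamma>" using \<open>\<alpha> \<subseteq> \<gamma>\<close> by (auto simp: pullback_def)
    ultimately have "(j x, j y) \<in> con_join \<sigma> N (?p \<alpha>) (?p \<beta> \<inter> ?p \<gamma>)"
      using Nmod P C unfolding con_modular_def by blast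
    also have "\<dots> \<subseteq> ?p ?K"
      using con_join_least[OF alg C(1) bg] P C
      by (intro con_join_least(4)[OF Nalg] Con_Int P) (auto simp: pullback_def)
    finally show "(x, y) \<in> ?K" using jF F by (auto simp: pullback_def)
  qed
qed

end

theory Submission
  imports Defs
begin

text \<open>Let \<open>\<phi>\<^sub>1\<close> lie over \<phi>, with \<phi> \<subseteq> \<psi>. The
  kernel is contained in \<phi> (\<open>Ker_subset_pullback\<close>), hence in \<psi>, so LO yields
  a prime \<open>\<psi>\<^sub>1\<close> over \<psi>. LO does not say how it compares with
  \<open>\<phi>\<^sub>1\<close>; the chain condition does. Either \<open>\<psi>\<^sub>1\<close> lies
  above \<open>\<phi>\<^sub>1\<close>, as GU asks, or it lies below, and then
  \<open>pullback_mono\<close> forces \<phi> = \<psi>. Part (2) reduces to (1), since primes are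
  congruences and a subset of a chain is a chain.\<close>

lemma pullback_mono: "\<theta> \<subseteq> \<psi> \<Longrightarrow> pullback A f \<theta> \<subseteq> pullback A f \<psi>"
  by (auto simp: pullback_def)

text \<open>By reflexivity a congruence of \<open>B\<close> contains the diagonal, whose pullback is
  the kernel. Thus the kernel condition in LO holds for every prime above a pulled-back
  congruence.\<close>

lemma Ker_subset_pullback:
  assumes "\<theta> \<in> Con \<sigma> B"
  shows "Ker A B f \<subseteq> pullback A f \<theta>"
proof -
  have "Id_on (carrier B) \<subseteq> \<theta>"
    using assms by (auto simp: Con_def equiv_def refl_on_def)
  then show ?thesis
    unfolding Ker_def by (rule pullback_mono)
qed

lemma Spec_subset_Con: "Spec \<sigma> M \<subseteq> Con \<sigma> M"
  by (auto simp: Spec_def)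

lemma lying_over_chain_imp_going_up:
  assumes LO: "lying_over \<sigma> A B f" and chain: "chain\<^sub>\<subseteq> (Spec \<sigma> B)"
  shows "going_up \<sigma> A B f"
  unfolding going_up_def
proof (intro ballI impI, elim conjE)
  fix \<phi> \<psi> \<phi>\<^sub>1
  assume \<psi>: "\<psi> \<in> Spec \<sigma> A" and \<phi>\<^sub>1: "\<phi>\<^sub>1 \<in> Spec \<sigma> B"
    and sub: "\<phi> \<subseteq> \<psi>" and \<phi>: "pullback A f \<phi>\<^sub>1 = \<phi>"
  have "Ker A B f \<subseteq> \<psi>"
    using Ker_subset_pullback[of \<phi>\<^sub>1 \<sigma> B A f] \<phi>\<^sub>1 Spec_subset_Con \<phi> sub by blast
  with LO \<psi> obtain \<psi>\<^sub>1 where \<psi>\<^sub>1: "\<psi>\<^sub>1 \<in> Spec \<sigma> B" "pullback A f \<psi>\<^sub>1 = \<psi>"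
    unfolding lying_over_def by blast
  from chain \<phi>\<^sub>1 \<psi>\<^sub>1(1) consider "\<phi>\<^sub>1 \<subseteq> \<psi>\<^sub>1" | "\<psi>\<^sub>1 \<subseteq> \<phi>\<^sub>1"
    unfolding chain_subset_def by blast
  then show "\<exists>\<psi>\<^sub>1\<in>Spec \<sigma> B. \<phi>\<^sub>1 \<subseteq> \<psi>\<^sub>1 \<and> pullback A f \<psi>\<^sub>1 = \<psi>"
  proof cases
    case 1
    with \<psi>\<^sub>1 show ?thesis by blast
  next
    case 2
    \<comment> \<open>With \<phi> \<subseteq> \<psi> this is an equality, so the witness is
      \<open>\<phi>\<^sub>1\<close> itself, not the prime obtained from LO.\<close>
    then have "\<psi> \<subseteq> \<phi>" using pullback_mono \<phi> \<psi>\<^sub>1(2) by blast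
    with sub \<phi> \<phi>\<^sub>1 show ?thesis by blast
  qed
qed

theorem proposition5p6:
  fixes \<sigma> :: "'f sig" and E :: "'f identities"
    and A :: "('f, 'a) algebra" and B :: "('f, 'b) algebra" and f :: "'a \<Rightarrow> 'b"
  assumes "wf_identities \<sigma> E" and "congruence_modular \<sigma> E"
    and "A \<in> equational_class \<sigma> E" and "B \<in> equational_class \<sigma> E"
    and "morphism \<sigma> A B f" and "admissible \<sigma> A B f"
  shows "(lying_over \<sigma> A B f \<and> chain\<^sub>\<subseteq> (Spec \<sigma> B) \<longrightarrow> going_up \<sigma> A B f) \<and>
         (lying_over \<sigma> A B f \<and> chain\<^sub>\<subseteq> (Con \<sigma> B) \<longrightarrow> going_up \<sigma> A B f)"
proof -
  have "chain\<^sub>\<subseteq> (Spec \<sigma> B)" if "chain\<^sub>\<subseteq> (Con \<sigma> B)"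
    using that Spec_subset_Con[of \<sigma> B] unfolding chain_subset_def by blast
  then show ?thesis
    using lying_over_chain_imp_going_up by blast
qed

end
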